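(* Let $X$ be a locally compact metrizable topological space with a fixed compatible metric $d$, let $\mathcal F=\{f_1,\dots,f_m\}$ be an iterated function system on $X$ with compact dynamics, and let $N$ be a chain node of $\mathcal F$. Then $N$ is forward-invariant, and $\Omega_{\mathcal F}(N)$ is a non-empty, compact, $H$-invariant, chain-equivalent subset of $N$.
   Context: An iterated function system (IFS) on $X$ is a finite collection $\mathcal F=\{f_1,\dots,f_m\}$, $m\ge 1$, of continuous maps $f_i:X\to X$. For a finite word $I=i_1\dots i_k$ ($k\ge 0$) in the alphabet $\{1,\dots,m\}$, $|I|=k$ and $\Phi^I_{\mathcal F}=f_{i_1}\circ\dots\circ f_{i_k}$ (the identity for the empty word). The orbit of $x$ is $\mathcal O_{\mathcal F}(x)=\{\Phi^I_{\mathcal F}(x): I \text{ a finite word}\}$, which contains $x$. For $A\subset X$, the limit set $\Omega_{\mathcal F}(A)$ is the set of $y\in X$ for which there are words $I_n$ with $|I_n|\to\infty$ and points $a_n\in A$ such that $\Phi^{I_n}_{\mathcal F}(a_n)\to y$. Put $H_{\mathcal F}(A)=\bigcup_{i=1}^m f_i(A)$. A set $A\subset X$ is forward-invariant if $f_i(A)\subset A$ for every $i$, and $H$-invariant if $H_{\mathcal F}(A)=A$. With $N_\varepsilon(A)=\{x: d(x,A)<\varepsilon\}$, $A$ attracts $K$ if for every $\varepsilon>0$ there is $\tau>0$ such that $\Phi^I_{\mathcal F}(K)\subset N_\varepsilon(A)$ for every word $I$ with $|I|\ge\tau$. A global attractor of $\mathcal F$ is a non-empty compact $H$-invariant set that attracts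 every compact subset of $X$. $\mathcal F$ has compact dynamics if it has a global attractor. Chains. For $\varepsilon>0$, an $\varepsilon$-chain from $x$ to $y$ is a finite sequence $x=x_0,x_1,\dots,x_k=y$ of points of $X$ ($k\ge 0$) together with indices $i_0,\dots,i_{k-1}\in\{1,\dots,m\}$ such that $d(f_{i_n}(x_n),x_{n+1})<\varepsilon$ for $n=0,\dots,k-1$. The point $y$ is downstream from $x$ if for every $\varepsilon>0$ there is an $\varepsilon$-chain from $x$ to $y$. Two points are chain-equivalent if each is downstream from the other; a set is chain-equivalent if any two of its points are chain-equivalent. The chain-recurrent set is the set of $x\in X$ such that $x$ is chain-equivalent to $z$ for every $z\in\mathcal O_{\mathcal F}(x)$. Chain-equivalence is an equivalence relation on the chain-recurrent set; its equivalence classes are the chain nodes. *)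

theory Defs
  imports "HOL-Analysis.Analysis"
begin

text \<open>
  An iterated function system \<open>{f\<^sub>1, \<dots>, f\<^sub>m}\<close> on a metric space is an indexed family \<open>f\<close> together
  with its number \<open>m\<close> of maps; only the values of \<open>f\<close> at indices in \<open>{1..m}\<close> are ever used.
\<close>

definition is_ifs :: "nat \<Rightarrow> (nat \<Rightarrow> 'a::metric_space \<Rightarrow> 'a) \<Rightarrow> bool" where
  "is_ifs m f \<longleftrightarrow> m \<ge> 1 \<and> (\<forall>i\<in>{1..m}. continuous_on UNIV (f i))"

definition ifs_words :: "nat \<Rightarrow> nat list set" where
  "ifs_words m = lists {1..m}"

text \<open>The leftmost letter of the word is the map that is applied last.\<close>

primrec ifs_comp :: "(nat \<Rightarrow> 'a \<Rightarrow> 'a) \<Rightarrow> nat list \<Rightarrow> 'a \<Rightarrow> 'a" where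
  "ifs_comp f [] = id"
| "ifs_comp f (i # I) = f i \<circ> ifs_comp f I"

definition ifs_orbit :: "nat \<Rightarrow> (nat \<Rightarrow> 'a \<Rightarrow> 'a) \<Rightarrow> 'a \<Rightarrow> 'a set" where
  "ifs_orbit m f x = {ifs_comp f I x | I. I \<in> ifs_words m}"

definition limit_set :: "nat \<Rightarrow> (nat \<Rightarrow> 'a::metric_space \<Rightarrow> 'a) \<Rightarrow> 'a set \<Rightarrow> 'a set" where
  "limit_set m f A =
    {y. \<exists>(I :: nat \<Rightarrow> nat list) (a :: nat \<Rightarrow> 'a).
          (\<forall>n. I n \<in> ifs_words m) \<and> filterlim (\<lambda>n. length (I n)) at_top sequentially \<and>
          (\<forall>n. a n \<in> A) \<and> (\<lambda>n. ifs_comp f (I n) (a n)) \<longlonglongrightarrow> y}"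

definition hutchinson :: "nat \<Rightarrow> (nat \<Rightarrow> 'a \<Rightarrow> 'a) \<Rightarrow> 'a set \<Rightarrow> 'a set" where
  "hutchinson m f A = (\<Union>i\<in>{1..m}. f i ` A)"

definition forward_invariant :: "nat \<Rightarrow> (nat \<Rightarrow> 'a \<Rightarrow> 'a) \<Rightarrow> 'a set \<Rightarrow> bool" where
  "forward_invariant m f A \<longleftrightarrow> (\<forall>i\<in>{1..m}. f i ` A \<subseteq> A)"

definition H_invariant :: "nat \<Rightarrow> (nat \<Rightarrow> 'a \<Rightarrow> 'a) \<Rightarrow> 'a set \<Rightarrow> bool" where
  "H_invariant m f A \<longleftrightarrow> hutchinson m f A = A"

text \<open>
  Since \<open>infdist x {} = 0\<close>, the neighbourhood is the intended one only for non-empty \<open>A\<close>;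
  it is used below only for global attractors, which are non-empty.
\<close>

definition eps_nbhd :: "real \<Rightarrow> 'a::metric_space set \<Rightarrow> 'a set" where
  "eps_nbhd \<epsilon> A = {x. infdist x A < \<epsilon>}"

definition attracts ::
    "nat \<Rightarrow> (nat \<Rightarrow> 'a::metric_space \<Rightarrow> 'a) \<Rightarrow> 'a set \<Rightarrow> 'a set \<Rightarrow> bool" where
  "attracts m f A K \<longleftrightarrow>
    (\<forall>\<epsilon>>0. \<exists>\<tau>::nat. \<tau> > 0 \<and>
       (\<forall>I\<in>ifs_words m. length I \<ge> \<tau> \<longrightarrow> ifs_comp f I ` K \<subseteq> eps_nbhd \<epsilon> A))"

definition global_attractor ::
    "nat \<Rightarrow> (nat \<Rightarrow> 'a::metric_space \<Rightarrow> 'a) \<Rightarrow> 'a set \<Rightarrow> bool" where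
  "global_attractor m f A \<longleftrightarrow>
    A \<noteq> {} \<and> compact A \<and> H_invariant m f A \<and> (\<forall>K. compact K \<longrightarrow> attracts m f A K)"

definition compact_dynamics :: "nat \<Rightarrow> (nat \<Rightarrow> 'a::metric_space \<Rightarrow> 'a) \<Rightarrow> bool" where
  "compact_dynamics m f \<longleftrightarrow> (\<exists>A. global_attractor m f A)"

text \<open>Chains of length \<open>k = 0\<close> are allowed, so every point is downstream from itself.\<close>

definition eps_chain ::
    "nat \<Rightarrow> (nat \<Rightarrow> 'a::metric_space \<Rightarrow> 'a) \<Rightarrow> real \<Rightarrow> 'a \<Rightarrow> 'a \<Rightarrow> bool" where
  "eps_chain m f \<epsilon> x y \<longleftrightarrow>
    (\<exists>(k::nat) (p :: nat \<Rightarrow> 'a) (j :: nat \<Rightarrow> nat).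
       p 0 = x \<and> p k = y \<and>
       (\<forall>n<k. j n \<in> {1..m} \<and> dist (f (j n) (p n)) (p (Suc n)) < \<epsilon>))"

definition downstream ::
    "nat \<Rightarrow> (nat \<Rightarrow> 'a::metric_space \<Rightarrow> 'a) \<Rightarrow> 'a \<Rightarrow> 'a \<Rightarrow> bool" where
  "downstream m f x y \<longleftrightarrow> (\<forall>\<epsilon>>0. eps_chain m f \<epsilon> x y)"

definition chain_equivalent ::
    "nat \<Rightarrow> (nat \<Rightarrow> 'a::metric_space \<Rightarrow> 'a) \<Rightarrow> 'a \<Rightarrow> 'a \<Rightarrow> bool" where
  "chain_equivalent m f x y \<longleftrightarrow> downstream m f x y \<and> downstream m f y x"

definition chain_equivalent_set ::
    "nat \<Rightarrow> (nat \<Rightarrow> 'a::metric_space \<Rightarrow> 'a) \<Rightarrow> 'a set \<Rightarrow> bool" where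
  "chain_equivalent_set m f A \<longleftrightarrow> (\<forall>x\<in>A. \<forall>y\<in>A. chain_equivalent m f x y)"

definition chain_recurrent_set ::
    "nat \<Rightarrow> (nat \<Rightarrow> 'a::metric_space \<Rightarrow> 'a) \<Rightarrow> 'a set" where
  "chain_recurrent_set m f = {x. \<forall>z\<in>ifs_orbit m f x. chain_equivalent m f x z}"

definition chain_relation ::
    "nat \<Rightarrow> (nat \<Rightarrow> 'a::metric_space \<Rightarrow> 'a) \<Rightarrow> 'a rel" where
  "chain_relation m f =
    {(x, y). x \<in> chain_recurrent_set m f \<and> y \<in> chain_recurrent_set m f \<and>
             chain_equivalent m f x y}"

definition chain_nodes ::
    "nat \<Rightarrow> (nat \<Rightarrow> 'a::metric_space \<Rightarrow> 'a) \<Rightarrow> 'a set set" where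
  "chain_nodes m f = chain_recurrent_set m f // chain_relation m f"

lemma eps_chain_refl: "eps_chain m f \<epsilon> x x"
  unfolding eps_chain_def by (rule exI[of _ 0]) auto

lemma eps_chain_trans:
  assumes "eps_chain m f \<epsilon> x y" "eps_chain m f \<epsilon> y z"
  shows "eps_chain m f \<epsilon> x z"
proof -
  obtain k p j where 1: "p 0 = x" "p k = y"
    "\<And>n. n < k \<Longrightarrow> j n \<in> {1..m} \<and> dist (f (j n) (p n)) (p (Suc n)) < \<epsilon>"
    using assms(1) unfolding eps_chain_def by blast
  obtain l q h where 2: "q 0 = y" "q l = z"
    "\<And>n. n < l \<Longrightarrow> h n \<in> {1..m} \<and> dist (f (h n) (q n)) (q (Suc n)) < \<epsilon>"
    using assms(2) unfolding eps_chain_def by blast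
  define r where "r = (\<lambda>n. if n \<le> k then p n else q (n - k))"
  define g where "g = (\<lambda>n. if n < k then j n else h (n - k))"
  have "g n \<in> {1..m} \<and> dist (f (g n) (r n)) (r (Suc n)) < \<epsilon>" if "n < k + l" for n
  proof (cases "n < k")
    case True
    then show ?thesis using 1(3) by (auto simp: r_def g_def)
  next
    case False
    have "r n = q (n - k)" "r (Suc n) = q (Suc (n - k))"
      using False 1(2) 2(1) by (auto simp: r_def Suc_diff_le)
    then show ?thesis using False that 2(3)[of "n - k"] by (auto simp: g_def)
  qed
  moreover have "r 0 = x" "r (k + l) = z"
    using 1(1,2) 2(1,2) by (auto simp: r_def)
  ultimately show ?thesis unfolding eps_chain_def by blast
qed

lemma equiv_chain_relation: "equiv (chain_recurrent_set m f) (chain_relation m f)"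
proof (rule equivI)
  show "refl_on (chain_recurrent_set m f) (chain_relation m f)"
    by (auto simp: refl_on_def chain_relation_def chain_equivalent_def downstream_def
        eps_chain_refl)
  show "sym (chain_relation m f)"
    by (auto simp: sym_def chain_relation_def chain_equivalent_def)
  show "trans (chain_relation m f)"
    unfolding trans_def chain_relation_def chain_equivalent_def downstream_def
    by (auto intro: eps_chain_trans)
qed (auto simp: chain_relation_def)

end

theory Submission
  imports Defs
begin

text \<open>
  The global attractor \<open>A\<close> turns the problem into one on a compact set. By local compactness,
  \<open>A\<close> has arbitrarily small compact neighbourhoods \<open>V\<close> that all maps send into the interior
  of \<open>V\<close> (\<open>attractor_trapping_neighbourhood\<close>), hence \<open>V\<close> cannot be left by
  \<open>\<epsilon>\<close>-chains when \<open>\<epsilon>\<close> is small. The orbit of a chain-recurrent point \<open>x\<close> enters every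
  such \<open>V\<close>, and chains lead from there back to \<open>x\<close>; so \<open>x\<close> lies in every \<open>V\<close>, that is,
  in \<open>A\<close> (\<open>chain_recurrent_subset_attractor\<close>).

  A chain node \<open>N\<close> is forward-invariant because the images of a chain-recurrent point are
  chain-recurrent and equivalent to it. As \<open>N\<close> lies in the compact forward-invariant set \<open>A\<close>,
  orbits of points of \<open>N\<close> accumulate, and the usual compactness arguments show that the limit
  set is non-empty, compact and \<open>H\<close>-invariant.

  For the chain statements, points outside \<open>N\<close> are joined to \<open>N\<close> by spending the error of one
  jump. A point \<open>p\<close> in the closure of \<open>N\<close> is followed by \<open>f\<^sub>1 p\<close>, which is close to a point
  \<open>f\<^sub>1 q\<close> of \<open>N\<close>, so a first jump leads from \<open>p\<close> into \<open>N\<close> (\<open>downstream_from_closure\<close>). A point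
  \<open>y\<close> of the limit set is close to some \<open>f\<^sub>i q\<close> with \<open>q\<close> in \<open>N\<close>, so a last jump leads from \<open>N\<close>
  to \<open>y\<close> (\<open>downstream_to_limit_set\<close>). In between one moves inside \<open>N\<close>, which is
  chain-equivalent. So every limit point is chain-equivalent to all of \<open>N\<close>. Its orbit
  consists of limit points, hence it is itself chain-recurrent and belongs to \<open>N\<close>.
\<close>

section \<open>Words and orbits\<close>

lemma ifs_comp_append: "ifs_comp f (I @ J) x = ifs_comp f I (ifs_comp f J x)"
  by (induction I) auto

lemma ifs_comp_in_forward_invariant:
  assumes "forward_invariant m f B" "I \<in> ifs_words m" "x \<in> B"
  shows "ifs_comp f I x \<in> B"
  using assms(2) unfolding ifs_words_def
proof (induction I)
  case (Cons i I)
  then have "f i ` B \<subseteq> B" using assms(1) unfolding forward_invariant_def by blast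
  then show ?case using Cons by auto
qed (use assms(3) in simp)

lemma continuous_on_ifs_comp:
  assumes "is_ifs m f" "I \<in> ifs_words m"
  shows "continuous_on UNIV (ifs_comp f I)"
  using assms(2) unfolding ifs_words_def
proof (induction I)
  case (Cons i I)
  then have "continuous_on UNIV (f i)" using assms(1) by (auto simp: is_ifs_def)
  then have "continuous_on UNIV (f i \<circ> ifs_comp f I)"
    using Cons.IH by (metis continuous_on_compose continuous_on_subset subset_UNIV)
  then show ?case by simp
qed (simp add: id_def)

lemma replicate_in_ifs_words:
  assumes "is_ifs m f"
  shows "replicate n 1 \<in> ifs_words m"
  using assms by (induction n) (auto simp: ifs_words_def is_ifs_def)

lemma finite_ifs_words_length_le: "finite {I \<in> ifs_words m. length I \<le> n}"
proof -
  have "{I \<in> ifs_words m. length I \<le> n} = {I. set I \<subseteq> {1..m} \<and> length I \<le> n}"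
    by (auto simp: ifs_words_def)
  then show ?thesis using finite_lists_length_le[of "{1..m}" n] by simp
qed

lemma H_invariant_imp_forward_invariant: "H_invariant m f A \<Longrightarrow> forward_invariant m f A"
  by (auto simp: H_invariant_def forward_invariant_def hutchinson_def)

section \<open>Elementary facts about chains\<close>

lemma eps_chain_step:
  assumes "i \<in> {1..m}" "dist (f i x) y < \<epsilon>"
  shows "eps_chain m f \<epsilon> x y"
  unfolding eps_chain_def
  by (rule exI[of _ 1], rule exI[of _ "\<lambda>n. if n = 0 then x else y"], rule exI[of _ "\<lambda>_. i"])
    (use assms in auto)

lemma downstream_trans:
  "downstream m f x y \<Longrightarrow> downstream m f y z \<Longrightarrow> downstream m f x z"
  unfolding downstream_def by (blast intro: eps_chain_trans)

lemma chain_equivalent_sym: "chain_equivalent m f x y \<Longrightarrow> chain_equivalent m f y x"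
  by (simp add: chain_equivalent_def)

lemma chain_equivalent_trans:
  "chain_equivalent m f x y \<Longrightarrow> chain_equivalent m f y z \<Longrightarrow> chain_equivalent m f x z"
  unfolding chain_equivalent_def by (blast intro: downstream_trans)

lemma eps_chain_trapped:
  assumes "eps_chain m f \<epsilon> x y" "x \<in> V"
    and trap: "\<And>i v w. i \<in> {1..m} \<Longrightarrow> v \<in> V \<Longrightarrow> dist (f i v) w < \<epsilon> \<Longrightarrow> w \<in> V"
  shows "y \<in> V"
proof -
  obtain k p j where p: "p 0 = x" "p k = y"
    "\<And>n. n < k \<Longrightarrow> j n \<in> {1..m} \<and> dist (f (j n) (p n)) (p (Suc n)) < \<epsilon>"
    using assms(1) unfolding eps_chain_def by blast
  have "n \<le> k \<Longrightarrow> p n \<in> V" for n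
  proof (induction n)
    case (Suc n)
    then show ?case using p(3)[of n] trap by auto
  qed (use p(1) assms(2) in simp)
  then show ?thesis using p(2) by blast
qed

section \<open>Chain-recurrent points lie in the global attractor\<close>

lemma infdist_less_imp_close_point:
  assumes "A \<noteq> {}" "infdist x A < e"
  obtains a where "a \<in> A" "dist x a < e"
proof -
  have "(INF a\<in>A. dist x a) < e" using assms by (simp add: infdist_notempty)
  then obtain d where "d \<in> dist x ` A" "d < e"
    using cInf_lessD[of "dist x ` A" e] assms(1) by auto
  then show ?thesis using that by auto
qed

lemma compact_closed_neighbourhood:
  fixes A :: "'a::metric_space set"
  assumes lc: "locally compact (UNIV :: 'a set)" and A: "compact A" "A \<noteq> {}" and "\<eta> > 0"
  obtains h where "0 < h" "h \<le> \<eta>" "compact {x. infdist x A \<le> h}"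
proof -
  have "\<exists>U K. open U \<and> x \<in> U \<and> U \<subseteq> K \<and> compact K" for x :: 'a
    using lc[unfolded locally_def, rule_format, of UNIV x] by auto
  then obtain U K where UK: "\<And>x::'a. open (U x)" "\<And>x. x \<in> U x" "\<And>x. U x \<subseteq> K x"
    "\<And>x. compact (K x)"
    by metis
  obtain C where C: "C \<subseteq> A" "finite C" "A \<subseteq> (\<Union>c\<in>C. U c)"
    using compactE_image[OF A(1), of A U] UK by blast
  have K: "compact (\<Union>c\<in>C. K c)" using C(2) UK(4) by blast
  obtain e where e: "e > 0" "(\<Union>x\<in>A. ball x e) \<subseteq> (\<Union>c\<in>C. U c)"
    by (rule compact_subset_open_imp_ball_epsilon_subset[OF A(1) _ C(3)])
      (use UK(1) in auto)
  define h where "h = min (e / 2) \<eta>"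
  have h: "0 < h" "h \<le> \<eta>" "h < e" using e(1) \<open>\<eta> > 0\<close> by (auto simp: h_def)
  have "{x. infdist x A \<le> h} \<subseteq> (\<Union>c\<in>C. K c)"
  proof
    fix x assume "x \<in> {x. infdist x A \<le> h}"
    then have "infdist x A < e" using h(3) by simp
    then obtain a where "a \<in> A" "dist x a < e"
      using infdist_less_imp_close_point[OF A(2)] by blast
    then have "x \<in> (\<Union>a\<in>A. ball a e)" by (auto simp: dist_commute)
    then have "x \<in> (\<Union>c\<in>C. U c)" using e(2) by (rule subsetD[rotated])
    then show "x \<in> (\<Union>c\<in>C. K c)" using UK(3) by blast
  qed
  moreover have "closed {x. infdist x A \<le> h}"
    by (intro closed_Collect_le continuous_intros)
  ultimately have "compact {x. infdist x A \<le> h}"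
    using compact_Int_closed[OF K] by (metis inf.absorb2)
  then show ?thesis using that h by blast
qed

text \<open>
  Attraction alone only says that a neighbourhood of \<open>A\<close> is mapped well inside itself by all
  words of some length \<open>\<tau>\<close>. To obtain a set that is trapping already for single letters, allow
  the point \<open>\<Phi>\<^sup>I x\<close> a distance from \<open>A\<close> that strictly decreases with \<open>|I| < \<tau>\<close>, from \<open>h\<close> at
  the empty word to just above \<open>h / 2\<close>: applying one more map shifts all words by one letter,
  so all the inequalities become strict, the words of length \<open>\<tau>\<close> being handled by attraction.
\<close>

lemma attractor_trapping_neighbourhood:
  fixes f :: "nat \<Rightarrow> 'a::metric_space \<Rightarrow> 'a"
  assumes lc: "locally compact (UNIV :: 'a set)" and ifs: "is_ifs m f"
    and att: "global_attractor m f A" and "\<eta> > 0"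
  obtains W V \<epsilon> where "open W" "A \<subseteq> W" "W \<subseteq> V" "\<forall>x\<in>V. infdist x A \<le> \<eta>" "\<epsilon> > 0"
    "\<forall>i\<in>{1..m}. \<forall>v\<in>V. \<forall>w. dist (f i v) w < \<epsilon> \<longrightarrow> w \<in> V"
proof -
  have A: "A \<noteq> {}" "compact A" "forward_invariant m f A"
    and attr: "\<And>K. compact K \<Longrightarrow> attracts m f A K"
    using att by (auto simp: global_attractor_def H_invariant_imp_forward_invariant)
  obtain h where h: "0 < h" "h \<le> \<eta>" and K: "compact {x. infdist x A \<le> h}"
    using compact_closed_neighbourhood[OF lc A(2,1) \<open>\<eta> > 0\<close>] by blast
  obtain \<tau> :: nat where \<tau>: "\<tau> > 0" "\<And>I. I \<in> ifs_words m \<Longrightarrow> length I \<ge> \<tau> \<Longrightarrow>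
      ifs_comp f I ` {x. infdist x A \<le> h} \<subseteq> eps_nbhd (h / 2) A"
    using attr[OF K] h(1) unfolding attracts_def by (metis half_gt_zero)
  define c where "c k = h * (1 - real k / (2 * real \<tau>))" for k
  have c0: "c 0 = h" by (simp add: c_def)
  have c_Suc: "c (Suc k) < c k" for k
    using h(1) \<tau>(1) by (simp add: c_def divide_strict_right_mono)
  have c_ge: "h / 2 \<le> c k" if "k \<le> \<tau>" for k
  proof -
    have "real k / (2 * real \<tau>) \<le> 1 / 2" using that \<tau>(1) by (simp add: field_simps)
    then have "h * (1 / 2) \<le> c k" unfolding c_def using h(1) by (intro mult_left_mono) auto
    then show ?thesis by simp
  qed
  define S where "S = {I \<in> ifs_words m. length I < \<tau>}"
  have "finite S"
    by (rule finite_subset[OF _ finite_ifs_words_length_le[of m \<tau>]]) (auto simp: S_def)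
  define V where "V = (\<Inter>I\<in>S. {x. infdist (ifs_comp f I x) A \<le> c (length I)})"
  define W where "W = (\<Inter>I\<in>S. {x. infdist (ifs_comp f I x) A < c (length I)})"
  have cont: "continuous_on UNIV (\<lambda>x. infdist (ifs_comp f I x) A)" if "I \<in> S" for I
    using that continuous_on_ifs_comp[OF ifs, of I]
    by (auto simp: S_def intro: continuous_on_infdist)
  have V_D: "infdist (ifs_comp f I x) A \<le> c (length I)" if "x \<in> V" "I \<in> S" for x I
    using that by (simp add: V_def)
  have nil: "[] \<in> S" using \<tau>(1) by (simp add: S_def ifs_words_def)
  have VK: "V \<subseteq> {x. infdist x A \<le> h}"
  proof
    fix x assume "x \<in> V"
    then show "x \<in> {x. infdist x A \<le> h}" using V_D[OF _ nil] by (simp add: c0)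
  qed
  have "closed V" unfolding V_def by (intro closed_INT ballI closed_Collect_le cont) auto
  then have "compact V" using compact_Int_closed[OF K] VK by (metis inf.absorb2)
  have "open W" unfolding W_def
    by (intro open_INT \<open>finite S\<close> ballI open_Collect_less cont) auto
  have "A \<subseteq> W"
  proof
    fix x assume "x \<in> A"
    have "infdist (ifs_comp f I x) A < c (length I)" if "I \<in> S" for I
    proof -
      have "ifs_comp f I x \<in> A"
        using ifs_comp_in_forward_invariant[OF A(3) _ \<open>x \<in> A\<close>] that by (simp add: S_def)
      moreover have "0 < c (length I)" using c_ge[of "length I"] that h(1) by (simp add: S_def)
      ultimately show ?thesis by simp
    qed
    then show "x \<in> W" by (simp add: W_def)
  qed
  have "W \<subseteq> V" by (force simp: W_def V_def)
  have into: "f i x \<in> W" if i: "i \<in> {1..m}" and x: "x \<in> V" for i x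
  proof -
    have "infdist (ifs_comp f J (f i x)) A < c (length J)" if J: "J \<in> S" for J
    proof -
      have word: "J @ [i] \<in> ifs_words m" using J i by (auto simp: S_def ifs_words_def)
      have eq: "ifs_comp f J (f i x) = ifs_comp f (J @ [i]) x" by (simp add: ifs_comp_append)
      show ?thesis
      proof (cases "Suc (length J) < \<tau>")
        case True
        then have "J @ [i] \<in> S" using word by (simp add: S_def)
        then have "infdist (ifs_comp f (J @ [i]) x) A \<le> c (Suc (length J))"
          using V_D[OF x] by fastforce
        then show ?thesis using c_Suc[of "length J"] eq by simp
      next
        case False
        then have "ifs_comp f (J @ [i]) x \<in> eps_nbhd (h / 2) A"
          using \<tau>(2)[OF word] x VK by auto
        then show ?thesis
          using c_ge[of "length J"] J eq by (simp add: eps_nbhd_def S_def)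
      qed
    qed
    then show ?thesis by (simp add: W_def)
  qed
  have "compact (\<Union>i\<in>{1..m}. f i ` V)"
  proof (intro compact_UN compact_continuous_image \<open>compact V\<close>)
    fix i assume "i \<in> {1..m}"
    then have "continuous_on UNIV (f i)" using ifs unfolding is_ifs_def by blast
    then show "continuous_on V (f i)" by (rule continuous_on_subset) simp
  qed simp
  moreover have "(\<Union>i\<in>{1..m}. f i ` V) \<subseteq> W" using into by blast
  ultimately obtain \<epsilon> where \<epsilon>: "\<epsilon> > 0" "(\<Union>y\<in>(\<Union>i\<in>{1..m}. f i ` V). ball y \<epsilon>) \<subseteq> W"
    using compact_subset_open_imp_ball_epsilon_subset[OF _ \<open>open W\<close>] by blast
  have trap: "w \<in> V" if "i \<in> {1..m}" "v \<in> V" "dist (f i v) w < \<epsilon>" for i v w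
  proof -
    have "f i v \<in> (\<Union>i\<in>{1..m}. f i ` V)" using that by blast
    moreover have "w \<in> ball (f i v) \<epsilon>" using that by simp
    ultimately have "w \<in> W" using \<epsilon>(2) by blast
    then show ?thesis using \<open>W \<subseteq> V\<close> by blast
  qed
  have "\<forall>x\<in>V. infdist x A \<le> \<eta>" using VK h(2) by auto
  then show ?thesis
    by (rule that[OF \<open>open W\<close> \<open>A \<subseteq> W\<close> \<open>W \<subseteq> V\<close> _ \<epsilon>(1)]) (use trap in blast)
qed

lemma chain_recurrent_subset_attractor:
  fixes f :: "nat \<Rightarrow> 'a::metric_space \<Rightarrow> 'a"
  assumes lc: "locally compact (UNIV :: 'a set)" and ifs: "is_ifs m f"
    and att: "global_attractor m f A"
  shows "chain_recurrent_set m f \<subseteq> A"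
proof
  fix x assume x: "x \<in> chain_recurrent_set m f"
  have A: "A \<noteq> {}" "compact A" and attr: "attracts m f A {x}"
    using att by (auto simp: global_attractor_def)
  have "infdist x A \<le> \<eta>" if \<eta>: "\<eta> > 0" for \<eta>
  proof -
    obtain W V \<epsilon> where V: "open W" "A \<subseteq> W" "W \<subseteq> V" "\<forall>x\<in>V. infdist x A \<le> \<eta>" "\<epsilon> > 0"
      "\<forall>i\<in>{1..m}. \<forall>v\<in>V. \<forall>w. dist (f i v) w < \<epsilon> \<longrightarrow> w \<in> V"
      by (rule attractor_trapping_neighbourhood[OF lc ifs att \<eta>])
    obtain e where e: "e > 0" "(\<Union>a\<in>A. ball a e) \<subseteq> W"
      using compact_subset_open_imp_ball_epsilon_subset[OF A(2) V(1,2)] by blast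
    obtain \<tau> :: nat where \<tau>: "\<And>I. I \<in> ifs_words m \<Longrightarrow> length I \<ge> \<tau> \<Longrightarrow>
        ifs_comp f I ` {x} \<subseteq> eps_nbhd e A"
      using attr e(1) unfolding attracts_def by metis
    define z where "z = ifs_comp f (replicate \<tau> 1) x"
    have word: "replicate \<tau> 1 \<in> ifs_words m" by (rule replicate_in_ifs_words[OF ifs])
    have "infdist z A < e" using \<tau>[OF word] by (simp add: z_def eps_nbhd_def)
    then obtain a where "a \<in> A" "dist z a < e"
      using infdist_less_imp_close_point[OF A(1)] by blast
    then have "z \<in> (\<Union>a\<in>A. ball a e)" by (auto simp: dist_commute)
    then have "z \<in> V" using e(2) V(3) by blast
    moreover have "z \<in> ifs_orbit m f x" using word by (auto simp: ifs_orbit_def z_def)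
    then have "eps_chain m f \<epsilon> z x"
      using x V(5) by (auto simp: chain_recurrent_set_def chain_equivalent_def downstream_def)
    ultimately have "x \<in> V" using eps_chain_trapped[of m f \<epsilon> z x V] V(6) by blast
    then show ?thesis using V(4) by blast
  qed
  then have "infdist x A \<le> 0" by (rule field_le_epsilon) simp
  then have "infdist x A = 0" using infdist_nonneg[of x A] by linarith
  then show "x \<in> A" using A by (simp add: in_closed_iff_infdist_zero compact_imp_closed)
qed

section \<open>Limit sets inside a compact forward-invariant set\<close>

text \<open>
  Trading the sequences in the definition of the limit set for a quantification over \<open>e\<close> and
  \<open>n\<close> makes closedness and the transport along the maps direct.
\<close>

lemma mem_limit_set_iff:
  "y \<in> limit_set m f B \<longleftrightarrow>
    (\<forall>e>0. \<forall>n. \<exists>I\<in>ifs_words m. \<exists>b\<in>B. n \<le> length I \<and> dist (ifs_comp f I b) y < e)"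
  (is "_ \<longleftrightarrow> ?R")
proof
  assume "y \<in> limit_set m f B"
  then obtain I b where I: "\<And>n. I n \<in> ifs_words m"
    "filterlim (\<lambda>n. length (I n)) at_top sequentially" "\<And>n. b n \<in> B"
    "(\<lambda>n. ifs_comp f (I n) (b n)) \<longlonglongrightarrow> y"
    unfolding limit_set_def by blast
  show ?R
  proof (intro allI impI)
    fix e :: real and n :: nat assume "e > 0"
    then have "\<forall>\<^sub>F k in sequentially. dist (ifs_comp f (I k) (b k)) y < e"
      using I(4) by (simp add: tendsto_iff)
    moreover have "\<forall>\<^sub>F k in sequentially. n \<le> length (I k)"
      using I(2) by (simp add: filterlim_at_top)
    ultimately have "\<forall>\<^sub>F k in sequentially. dist (ifs_comp f (I k) (b k)) y < e \<and> n \<le> length (I k)"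
      by (rule eventually_conj)
    then obtain k where "dist (ifs_comp f (I k) (b k)) y < e" "n \<le> length (I k)"
      using eventually_happens' sequentially_bot by blast
    then show "\<exists>I\<in>ifs_words m. \<exists>b\<in>B. n \<le> length I \<and> dist (ifs_comp f I b) y < e"
      using I(1,3) by blast
  qed
next
  assume R: ?R
  have "\<exists>I b. I \<in> ifs_words m \<and> b \<in> B \<and> n \<le> length I \<and> dist (ifs_comp f I b) y < 1 / real (Suc n)"
    for n
    using R[rule_format, of "1 / real (Suc n)" n] by auto
  then obtain I b where I: "\<And>n. I n \<in> ifs_words m" "\<And>n. b n \<in> B" "\<And>n. n \<le> length (I n)"
    "\<And>n. dist (ifs_comp f (I n) (b n)) y < 1 / real (Suc n)"
    by metis
  have "filterlim (\<lambda>n. length (I n)) at_top sequentially"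
    by (rule filterlim_at_top_mono[OF filterlim_ident]) (simp add: I(3))
  moreover have "(\<lambda>n. ifs_comp f (I n) (b n)) \<longlonglongrightarrow> y"
  proof (rule metric_LIMSEQ_I)
    fix r :: real assume "r > 0"
    then obtain k where k: "1 / real (Suc k) < r" using nat_approx_posE by metis
    have "dist (ifs_comp f (I n) (b n)) y < r" if "n \<ge> k" for n
    proof -
      have "1 / real (Suc n) \<le> 1 / real (Suc k)" using that by (simp add: frac_le)
      then show ?thesis using I(4)[of n] k by linarith
    qed
    then show "\<exists>k. \<forall>n\<ge>k. dist (ifs_comp f (I n) (b n)) y < r" by blast
  qed
  ultimately show "y \<in> limit_set m f B" using I(1,2) unfolding limit_set_def by blast
qed

lemma limit_set_subset_closed:
  assumes "closed A" "forward_invariant m f A" "B \<subseteq> A"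
  shows "limit_set m f B \<subseteq> A"
proof
  fix y assume "y \<in> limit_set m f B"
  then have "\<exists>a\<in>A. dist a y < e" if "e > 0" for e
    using that ifs_comp_in_forward_invariant[OF assms(2)] assms(3)
    unfolding mem_limit_set_iff by (meson subsetD)
  then show "y \<in> A" using closure_approachable[of y A] assms(1) by simp
qed

lemma closed_limit_set: "closed (limit_set m f B)"
proof -
  have "y \<in> limit_set m f B" if y: "y \<in> closure (limit_set m f B)" for y
    unfolding mem_limit_set_iff
  proof (intro allI impI)
    fix e :: real and n :: nat assume "e > 0"
    then obtain z where z: "z \<in> limit_set m f B" "dist z y < e / 2"
      using y unfolding closure_approachable by (meson half_gt_zero)
    have "0 < e / 2" using \<open>e > 0\<close> by simp
    then obtain I b where "I \<in> ifs_words m" "b \<in> B" "n \<le> length I" "dist (ifs_comp f I b) z < e / 2"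
      using z(1) unfolding mem_limit_set_iff by blast
    then show "\<exists>I\<in>ifs_words m. \<exists>b\<in>B. n \<le> length I \<and> dist (ifs_comp f I b) y < e"
      using dist_triangle_half_r z(2) by (metis dist_commute)
  qed
  then show ?thesis by (simp add: closure_subset_eq[symmetric] subsetI)
qed

lemma forward_invariant_limit_set:
  assumes ifs: "is_ifs m f"
  shows "forward_invariant m f (limit_set m f B)"
  unfolding forward_invariant_def
proof (intro ballI subsetI)
  fix i z assume i: "i \<in> {1..m}" and "z \<in> f i ` limit_set m f B"
  then obtain y where y: "y \<in> limit_set m f B" "z = f i y" by blast
  have "isCont (f i) y" using ifs i by (simp add: is_ifs_def continuous_on_eq_continuous_at)
  show "z \<in> limit_set m f B"
    unfolding mem_limit_set_iff
  proof (intro allI impI)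
    fix e :: real and n :: nat assume "e > 0"
    then obtain d where d: "d > 0" "\<And>x. dist x y < d \<Longrightarrow> dist (f i x) (f i y) < e"
      using \<open>isCont (f i) y\<close> unfolding continuous_at_eps_delta by blast
    obtain I b where I: "I \<in> ifs_words m" "b \<in> B" "n \<le> length I" "dist (ifs_comp f I b) y < d"
      using y(1) d(1) unfolding mem_limit_set_iff by blast
    have "i # I \<in> ifs_words m" using I(1) i by (simp add: ifs_words_def)
    moreover have "dist (ifs_comp f (i # I) b) z < e" using d(2)[OF I(4)] y(2) by simp
    moreover have "n \<le> length (i # I)" using I(3) by simp
    ultimately show "\<exists>I\<in>ifs_words m. \<exists>b\<in>B. n \<le> length I \<and> dist (ifs_comp f I b) z < e"
      using I(2) by blast
  qed
qed

text \<open>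
  The letter applied last is part of the data that converges along a subsequence: it
  is eventually constant there, and compactness of \<open>{1..m} \<times> A\<close> yields the letter
  and the preimage at the same time.
\<close>

lemma limit_set_subset_hutchinson:
  fixes f :: "nat \<Rightarrow> 'a::metric_space \<Rightarrow> 'a"
  assumes ifs: "is_ifs m f" and A: "compact A" "forward_invariant m f A" "B \<subseteq> A"
  shows "limit_set m f B \<subseteq> hutchinson m f (limit_set m f B)"
proof
  fix y assume "y \<in> limit_set m f B"
  then obtain I b where I: "\<And>n. I n \<in> ifs_words m"
    "filterlim (\<lambda>n. length (I n)) at_top sequentially" "\<And>n. b n \<in> B"
    and lim: "(\<lambda>n. ifs_comp f (I n) (b n)) \<longlonglongrightarrow> y"
    unfolding limit_set_def by blast
  \<comment> \<open>The letter and the tail are meaningful only for non-empty words; the empty ones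
    get a dummy letter, which is harmless because the lengths tend to infinity.\<close>
  define i where "i n = (if I n = [] then 1 else hd (I n))" for n
  define z where "z n = ifs_comp f (tl (I n)) (b n)" for n
  have tl: "tl (I n) \<in> ifs_words m" for n
    using I(1)[of n] by (cases "I n") (auto simp: ifs_words_def)
  have "i n \<in> {1..m}" for n
    using I(1)[of n] ifs by (cases "I n") (auto simp: i_def ifs_words_def is_ifs_def)
  moreover have "z n \<in> A" for n
    unfolding z_def using ifs_comp_in_forward_invariant[OF A(2) tl] I(3) A(3) by blast
  ultimately have "\<forall>n. (i n, z n) \<in> {1..m} \<times> A" by blast
  moreover have "seq_compact ({1..m} \<times> A)"
    by (intro compact_imp_seq_compact compact_Times finite_imp_compact A) simp
  ultimately obtain l r where l: "l \<in> {1..m} \<times> A" "strict_mono r"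
    "((\<lambda>n. (i n, z n)) \<circ> r) \<longlonglongrightarrow> l"
    using seq_compactE[of "{1..m} \<times> A" "\<lambda>n. (i n, z n)"] by blast
  obtain k w where kw: "l = (k, w)" by (cases l)
  have "(\<lambda>n. i (r n)) \<longlonglongrightarrow> k" and zw: "(\<lambda>n. z (r n)) \<longlonglongrightarrow> w"
    using tendsto_fst[OF l(3)] tendsto_snd[OF l(3)] by (auto simp: kw o_def)
  then have ik: "\<forall>\<^sub>F n in sequentially. i (r n) = k" by (simp add: tendsto_discrete)
  have k: "k \<in> {1..m}" using l(1) kw by simp
  have len: "filterlim (\<lambda>n. length (I (r n))) at_top sequentially"
    using filterlim_compose[OF I(2) filterlim_subseq[OF l(2)]] .
  then have "filterlim (\<lambda>n. length (tl (I (r n)))) at_top sequentially"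
    unfolding filterlim_at_top
  proof (intro allI)
    fix N assume *: "\<forall>Z. \<forall>\<^sub>F n in sequentially. Z \<le> length (I (r n))"
    show "\<forall>\<^sub>F n in sequentially. N \<le> length (tl (I (r n)))"
      using *[rule_format, of "Suc N"] by eventually_elim simp
  qed
  then have "w \<in> limit_set m f B"
    unfolding limit_set_def using tl I(3) zw[unfolded z_def]
    by (intro CollectI exI[of _ "\<lambda>n. tl (I (r n))"] exI[of _ "\<lambda>n. b (r n)"]) auto
  moreover have "f k w = y"
  proof (rule LIMSEQ_unique)
    have "isCont (f k) w" using ifs k by (simp add: is_ifs_def continuous_on_eq_continuous_at)
    then show "(\<lambda>n. f k (z (r n))) \<longlonglongrightarrow> f k w" using zw isCont_tendsto_compose by blast
    have "\<forall>\<^sub>F n in sequentially. 1 \<le> length (I (r n))"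
      using len by (simp add: filterlim_at_top)
    then have "\<forall>\<^sub>F n in sequentially. ifs_comp f (I (r n)) (b (r n)) = f k (z (r n))"
      using ik
    proof eventually_elim
      case (elim n)
      then show ?case by (cases "I (r n)") (auto simp: i_def z_def)
    qed
    moreover have "(\<lambda>n. ifs_comp f (I (r n)) (b (r n))) \<longlonglongrightarrow> y"
      using LIMSEQ_subseq_LIMSEQ[OF lim l(2)] by (simp add: o_def)
    ultimately show "(\<lambda>n. f k (z (r n))) \<longlonglongrightarrow> y" using tendsto_cong by fastforce
  qed
  ultimately show "y \<in> hutchinson m f (limit_set m f B)"
    using k unfolding hutchinson_def by blast
qed

lemma limit_set_nonempty:
  fixes f :: "nat \<Rightarrow> 'a::metric_space \<Rightarrow> 'a"
  assumes ifs: "is_ifs m f" and A: "compact A" "forward_invariant m f A" "B \<subseteq> A" and "B \<noteq> {}"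
  shows "limit_set m f B \<noteq> {}"
proof -
  obtain b where b: "b \<in> B" using \<open>B \<noteq> {}\<close> by blast
  define z where "z n = ifs_comp f (replicate n 1) b" for n
  have "\<forall>n. z n \<in> A"
    unfolding z_def using ifs_comp_in_forward_invariant[OF A(2) replicate_in_ifs_words[OF ifs]]
      b A(3) by blast
  then obtain y r where y: "strict_mono r" "(z \<circ> r) \<longlonglongrightarrow> y"
    using compact_imp_seq_compact[OF A(1)] by (metis seq_compactE)
  have "y \<in> limit_set m f B"
    unfolding limit_set_def
  proof (intro CollectI exI conjI allI)
    show "replicate (r n) 1 \<in> ifs_words m" for n by (rule replicate_in_ifs_words[OF ifs])
    show "filterlim (\<lambda>n. length (replicate (r n) (1::nat))) at_top sequentially"
      using filterlim_subseq[OF y(1)] by simp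
    show "b \<in> B" for n :: nat by (rule b)
    show "(\<lambda>n. ifs_comp f (replicate (r n) 1) b) \<longlonglongrightarrow> y"
      using y(2) by (simp add: z_def o_def)
  qed
  then show ?thesis by blast
qed

section \<open>Moving between a chain-equivalent set and its limit points\<close>

text \<open>
  The error of a jump is spent after a map has been applied: \<open>p\<close> cannot be replaced by a
  nearby point \<open>q\<close> of \<open>N\<close>, but \<open>f\<^sub>1 p\<close> can be replaced by \<open>f\<^sub>1 q\<close>, which is still in
  \<open>N\<close> by forward-invariance.
\<close>

lemma downstream_from_closure:
  assumes ifs: "is_ifs m f" and N: "forward_invariant m f N" "chain_equivalent_set m f N"
    and p: "p \<in> closure N" and x: "x \<in> N"
  shows "downstream m f p x"
  unfolding downstream_def
proof (intro allI impI)
  fix e :: real assume e: "e > 0"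
  have i: "1 \<in> {1..m}" using ifs by (simp add: is_ifs_def)
  then have "isCont (f 1) p" using ifs by (simp add: is_ifs_def continuous_on_eq_continuous_at)
  then obtain d where d: "d > 0" "\<And>q. dist q p < d \<Longrightarrow> dist (f 1 q) (f 1 p) < e"
    using e unfolding continuous_at_eps_delta by blast
  obtain q where q: "q \<in> N" "dist q p < d" using p d(1) unfolding closure_approachable by blast
  have "eps_chain m f e p (f 1 q)"
    by (rule eps_chain_step[OF i]) (use d(2)[OF q(2)] in \<open>simp add: dist_commute\<close>)
  moreover have "f 1 q \<in> N" using N(1) i q(1) unfolding forward_invariant_def by blast
  then have "eps_chain m f e (f 1 q) x"
    using N(2) x e by (simp add: chain_equivalent_set_def chain_equivalent_def downstream_def)
  ultimately show "eps_chain m f e p x" by (rule eps_chain_trans)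
qed

text \<open>
  Here the last letter of an orbit that ends near \<open>y\<close> is applied separately, so that the
  distance to \<open>y\<close> is the error of that one jump, starting from a point of \<open>N\<close>.
\<close>

lemma downstream_to_limit_set:
  assumes N: "forward_invariant m f N" "chain_equivalent_set m f N"
    and x: "x \<in> N" and y: "y \<in> limit_set m f N"
  shows "downstream m f x y"
  unfolding downstream_def
proof (intro allI impI)
  fix e :: real assume e: "e > 0"
  obtain I b where I: "I \<in> ifs_words m" "b \<in> N" "1 \<le> length I" "dist (ifs_comp f I b) y < e"
    using y e unfolding mem_limit_set_iff by blast
  obtain i J where iJ: "I = i # J" using I(3) by (cases I) auto
  then have i: "i \<in> {1..m}" and J: "J \<in> ifs_words m" using I(1) by (auto simp: ifs_words_def)
  have "ifs_comp f J b \<in> N" by (rule ifs_comp_in_forward_invariant[OF N(1) J I(2)])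
  then have "eps_chain m f e x (ifs_comp f J b)"
    using N(2) x e by (simp add: chain_equivalent_set_def chain_equivalent_def downstream_def)
  moreover have "eps_chain m f e (ifs_comp f J b) y"
    using eps_chain_step[OF i] I(4) iJ by simp
  ultimately show "eps_chain m f e x y" by (rule eps_chain_trans)
qed

lemma limit_set_chain_equivalent:
  assumes ifs: "is_ifs m f" and N: "forward_invariant m f N" "chain_equivalent_set m f N"
    and x: "x \<in> N" and y: "y \<in> limit_set m f N"
  shows "chain_equivalent m f x y"
proof -
  have "forward_invariant m f (closure N)"
    unfolding forward_invariant_def
  proof
    fix i assume i: "i \<in> {1..m}"
    then have "continuous_on UNIV (f i)" using ifs unfolding is_ifs_def by blast
    then have "continuous_on (closure N) (f i)" by (rule continuous_on_subset) simp
    then show "f i ` closure N \<subseteq> closure N"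
      by (rule image_closure_subset)
        (use N(1) i closure_subset[of N] in \<open>auto simp: forward_invariant_def image_subset_iff\<close>)
  qed
  then have "y \<in> closure N"
    using limit_set_subset_closed[OF closed_closure _ closure_subset] y by blast
  then show ?thesis
    using downstream_from_closure[OF ifs N _ x] downstream_to_limit_set[OF N x y]
    by (simp add: chain_equivalent_def)
qed

section \<open>Chain nodes\<close>

lemma chain_recurrent_image:
  assumes x: "x \<in> chain_recurrent_set m f" and i: "i \<in> {1..m}"
  shows "f i x \<in> chain_recurrent_set m f" "chain_equivalent m f x (f i x)"
proof -
  have orbit: "ifs_comp f I (f i x) \<in> ifs_orbit m f x" if "I \<in> ifs_words m" for I
    unfolding ifs_orbit_def using that i
    by (intro CollectI exI[of _ "I @ [i]"]) (auto simp: ifs_comp_append ifs_words_def)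
  have "f i x \<in> ifs_orbit m f x" using orbit[of "[]"] by (simp add: ifs_words_def)
  then show eq: "chain_equivalent m f x (f i x)" using x by (simp add: chain_recurrent_set_def)
  have "chain_equivalent m f (f i x) z" if "z \<in> ifs_orbit m f (f i x)" for z
  proof -
    have "z \<in> ifs_orbit m f x"
      using that orbit unfolding ifs_orbit_def[of _ _ "f i x"] by blast
    then have "chain_equivalent m f x z" using x by (simp add: chain_recurrent_set_def)
    then show ?thesis using chain_equivalent_trans chain_equivalent_sym eq by blast
  qed
  then show "f i x \<in> chain_recurrent_set m f" by (simp add: chain_recurrent_set_def)
qed

lemma chain_nodeE:
  assumes "N \<in> chain_nodes m f"
  obtains x where "x \<in> N"
    "N = {y \<in> chain_recurrent_set m f. chain_equivalent m f x y}"
proof -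
  obtain x where x: "x \<in> chain_recurrent_set m f" "N = chain_relation m f `` {x}"
    using assms unfolding chain_nodes_def by (rule quotientE)
  then have "x \<in> N" using equiv_class_self[OF equiv_chain_relation] by blast
  moreover have "N = {y \<in> chain_recurrent_set m f. chain_equivalent m f x y}"
    using x by (auto simp: chain_relation_def)
  ultimately show ?thesis by (rule that)
qed

lemma forward_invariant_chain_node:
  assumes "N \<in> chain_nodes m f"
  shows "forward_invariant m f N"
proof -
  obtain x where N: "N = {y \<in> chain_recurrent_set m f. chain_equivalent m f x y}"
    using chain_nodeE[OF assms] by blast
  show ?thesis
    unfolding forward_invariant_def N
    using chain_recurrent_image chain_equivalent_trans by blast
qed

lemma chain_equivalent_set_chain_node:
  assumes "N \<in> chain_nodes m f"
  shows "chain_equivalent_set m f N"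
proof -
  obtain x where "N = {y \<in> chain_recurrent_set m f. chain_equivalent m f x y}"
    using chain_nodeE[OF assms] by blast
  then show ?thesis
    unfolding chain_equivalent_set_def
    by (auto intro: chain_equivalent_trans[OF chain_equivalent_sym])
qed

theorem theorem3:
  fixes m :: nat and f :: "nat \<Rightarrow> 'a::metric_space \<Rightarrow> 'a" and N :: "'a set"
  assumes "locally compact (UNIV :: 'a set)"
    and "is_ifs m f"
    and "compact_dynamics m f"
    and "N \<in> chain_nodes m f"
  shows "forward_invariant m f N \<and>
    limit_set m f N \<noteq> {} \<and>
    compact (limit_set m f N) \<and>
    H_invariant m f (limit_set m f N) \<and>
    chain_equivalent_set m f (limit_set m f N) \<and>
    limit_set m f N \<subseteq> N"
proof -
  note ifs = assms(2)
  let ?L = "limit_set m f N"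
  obtain A where att: "global_attractor m f A" using assms(3) unfolding compact_dynamics_def by blast
  then have A: "compact A" "forward_invariant m f A"
    by (auto simp: global_attractor_def H_invariant_imp_forward_invariant)
  obtain x where x: "x \<in> N"
    and N: "N = {y \<in> chain_recurrent_set m f. chain_equivalent m f x y}"
    by (rule chain_nodeE[OF assms(4)])
  have NA: "N \<subseteq> A" using chain_recurrent_subset_attractor[OF assms(1) ifs att] N by blast
  have fwd: "forward_invariant m f N" by (rule forward_invariant_chain_node[OF assms(4)])
  have eqv: "chain_equivalent_set m f N" by (rule chain_equivalent_set_chain_node[OF assms(4)])
  have "?L \<noteq> {}" using limit_set_nonempty[OF ifs A NA] x by blast
  moreover have "compact ?L"
    using compact_Int_closed[OF A(1) closed_limit_set, of m f N]
      limit_set_subset_closed[OF compact_imp_closed[OF A(1)] A(2) NA]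
    by (metis inf.absorb2)
  moreover have fwdL: "forward_invariant m f ?L" by (rule forward_invariant_limit_set[OF ifs])
  then have "H_invariant m f ?L"
    using limit_set_subset_hutchinson[OF ifs A NA]
    by (auto simp: H_invariant_def hutchinson_def forward_invariant_def)
  moreover have xL: "chain_equivalent m f x y" if "y \<in> ?L" for y
    by (rule limit_set_chain_equivalent[OF ifs fwd eqv x that])
  then have eqvL: "chain_equivalent_set m f ?L"
    unfolding chain_equivalent_set_def
    by (blast intro: chain_equivalent_trans[OF chain_equivalent_sym[OF xL] xL])
  moreover have "?L \<subseteq> N"
  proof
    fix y assume y: "y \<in> ?L"
    have "z \<in> ?L" if "z \<in> ifs_orbit m f y" for z
      using that ifs_comp_in_forward_invariant[OF fwdL _ y] by (auto simp: ifs_orbit_def)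
    then have "y \<in> chain_recurrent_set m f"
      using eqvL y by (simp add: chain_recurrent_set_def chain_equivalent_set_def)
    then show "y \<in> N" using xL[OF y] N by blast
  qed
  ultimately show ?thesis using fwd by blast
qed

end
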